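(* Let $\varepsilon>0$ and let $G$ be a graph on $V=L\cup R$ ($L,R$ disjoint) with $|V|\le n$. If one has to change (add or delete) at least $\varepsilon n^2$ edges of the bipartite graph $G[L,R]$ to make it $M_2$-free, then a set $X\subseteq V$ chosen uniformly at random among subsets of $V$ of size $\frac{4}{\varepsilon}\ln\frac1\varepsilon$ induces a bipartite graph $G[L\cap X,R\cap X]$ that contains an $M_2$ with probability at least $\tfrac12$.
   Context: $G[L,R]$ is the bipartite graph with parts $L,R$ whose edges are the edges of $G$ between $L$ and $R$; changes are only to pairs with one end in $L$ and one in $R$. An $M_2$ in $G[L,R]$ is a set of distinct vertices $\ell_1,\ell_2\in L$, $r_1,r_2\in R$ with $\ell_1r_1,\ell_2r_2$ edges and $\ell_1r_2,\ell_2r_1$ non-edges; $M_2$-free means containing no $M_2$. *)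

theory Defs
  imports "HOL-Probability.Probability"
begin

text \<open>
  A graph is given by a vertex set \<open>V\<close> and a set \<open>E\<close> of two-element subsets of \<open>V\<close>.
  Bipartite graphs with parts \<open>L\<close>, \<open>R\<close> are subsets of \<open>cross_pairs L R\<close>.
\<close>

definition simple_graph :: "'a set \<Rightarrow> 'a set set \<Rightarrow> bool" where
  "simple_graph V E \<longleftrightarrow> finite V \<and> (\<forall>e\<in>E. e \<subseteq> V \<and> card e = 2)"

definition cross_pairs :: "'a set \<Rightarrow> 'a set \<Rightarrow> 'a set set" where
  "cross_pairs L R = {{l, r} | l r. l \<in> L \<and> r \<in> R}"

definition bip :: "'a set set \<Rightarrow> 'a set \<Rightarrow> 'a set \<Rightarrow> 'a set set" where
  "bip E L R = E \<inter> cross_pairs L R"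

definition contains_M2 :: "'a set \<Rightarrow> 'a set \<Rightarrow> 'a set set \<Rightarrow> bool" where
  "contains_M2 L R F \<longleftrightarrow>
     (\<exists>l1\<in>L. \<exists>l2\<in>L. \<exists>r1\<in>R. \<exists>r2\<in>R. distinct [l1, l2, r1, r2] \<and>
        {l1, r1} \<in> F \<and> {l2, r2} \<in> F \<and> {l1, r2} \<notin> F \<and> {l2, r1} \<notin> F)"

text \<open>\<open>C\<close> is the set of changed pairs: those in \<open>F\<close> are deleted, the others are added.\<close>

definition change :: "'a set set \<Rightarrow> 'a set set \<Rightarrow> 'a set set" where
  "change F C = (F - C) \<union> (C - F)"

definition M2_free_needs :: "'a set \<Rightarrow> 'a set \<Rightarrow> 'a set set \<Rightarrow> real \<Rightarrow> bool" where
  "M2_free_needs L R F d \<longleftrightarrow>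
     (\<forall>C \<subseteq> cross_pairs L R. \<not> contains_M2 L R (change F C) \<longrightarrow> d \<le> real (card C))"

text \<open>
  The size is rounded up to an integer. If \<open>V\<close> has fewer vertices than that, the sample
  is all of \<open>V\<close>; in particular the family below is never empty for finite \<open>V\<close>, as
  \<open>pmf_of_set\<close> requires.
\<close>

definition sample_size :: "real \<Rightarrow> nat" where
  "sample_size \<epsilon> = nat \<lceil>4 / \<epsilon> * ln (1 / \<epsilon>)\<rceil>"

definition samples :: "'a set \<Rightarrow> nat \<Rightarrow> 'a set set" where
  "samples V q = {X. X \<subseteq> V \<and> card X = min q (card V)}"

end

theory Submission
  imports Defs
begin

text \<open>
  A bipartite graph is \<open>M\<^sub>2\<close>-free iff the neighbourhoods of its right vertices form a chain.
  Given an \<open>M\<^sub>2\<close>-free vertex set \<open>S\<close>, predict an edge \<open>vw\<close> iff \<open>v\<close> has a neighbour \<open>r \<in> S\<close> whose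
  neighbourhood in \<open>S\<close> is contained in that of \<open>w\<close>. The predicted graph on all of \<open>V\<close> is again
  \<open>M\<^sub>2\<close>-free, so it errs on at least \<open>\<epsilon>n\<^sup>2\<close> pairs. On the other hand, if \<open>t\<close> samples span an
  \<open>M\<^sub>2\<close>-free graph, then at most \<open>t\<close> of the ordered pairs of sampled vertices are mispredicted by
  the remaining \<open>t - 2\<close> samples. Exchangeability of independent samples therefore gives, for the
  probability \<open>p\<^sub>t\<close> that \<open>t\<close> of them are \<open>M\<^sub>2\<close>-free, the inequality
  \<open>2\<epsilon>p\<^sub>t \<le> (p\<^sub>t - p\<^sub>t\<^sub>+\<^sub>2) + 2/(t + 1)\<close>, which, as \<open>\<epsilon> \<le> 1/8\<close>, forces \<open>p\<^sub>q \<le> 1/2\<close>. Sampling without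
  replacement is at least as good, because \<open>M\<^sub>2\<close>-freeness is hereditary.
\<close>

section \<open>Free vertex sets and the graph predicted from a sample\<close>

text \<open>An arbitrary relation \<open>A\<close> stands in for the edge set so that the notion
  also covers predicted graphs. Quadruples with \<open>l1 = l2\<close> or \<open>r1 = r2\<close>
  satisfy the implication trivially, so only genuine crossings are forbidden.\<close>

definition crossing_free :: "('a \<Rightarrow> 'a \<Rightarrow> bool) \<Rightarrow> 'a set \<Rightarrow> 'a set \<Rightarrow> 'a set \<Rightarrow> bool" where
  "crossing_free A L R X \<longleftrightarrow>
     (\<forall>l1\<in>L \<inter> X. \<forall>l2\<in>L \<inter> X. \<forall>r1\<in>R \<inter> X. \<forall>r2\<in>R \<inter> X.
        A l1 r1 \<longrightarrow> A l2 r2 \<longrightarrow> A l1 r2 \<or> A l2 r1)"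

lemma crossing_freeD:
  assumes "crossing_free A L R X" "l1 \<in> L" "l1 \<in> X" "l2 \<in> L" "l2 \<in> X" "r1 \<in> R" "r1 \<in> X" "r2 \<in> R" "r2 \<in> X"
    "A l1 r1" "A l2 r2"
  shows "A l1 r2 \<or> A l2 r1"
  using assms unfolding crossing_free_def by blast

lemma crossing_free_subset:
  "crossing_free A L R X \<Longrightarrow> Y \<subseteq> X \<Longrightarrow> crossing_free A L R Y"
  unfolding crossing_free_def by blast

definition predict :: "('a \<Rightarrow> 'a \<Rightarrow> bool) \<Rightarrow> 'a set \<Rightarrow> 'a set \<Rightarrow> 'a set \<Rightarrow> 'a \<Rightarrow> 'a \<Rightarrow> bool" where
  "predict A L R S v w \<longleftrightarrow> (\<exists>r\<in>R \<inter> S. A v r \<and> (\<forall>l\<in>L \<inter> S. A l r \<longrightarrow> A l w))"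

text \<open>Errors are oriented from \<open>L\<close> to \<open>R\<close>. For disjoint parts a pair
  therefore counts in one order only, so looking at both orders later doubles the number of
  errors.\<close>

definition mispredicted :: "('a \<Rightarrow> 'a \<Rightarrow> bool) \<Rightarrow> 'a set \<Rightarrow> 'a set \<Rightarrow> 'a set \<Rightarrow> 'a \<Rightarrow> 'a \<Rightarrow> bool" where
  "mispredicted A L R S v w \<longleftrightarrow> v \<in> L \<and> w \<in> R \<and> predict A L R S v w \<noteq> A v w"

text \<open>The neighbourhoods in \<open>S\<close> of sampled right vertices form a chain. Of the
  witnesses \<open>r1\<close>, \<open>r2\<close> for two predicted edges, the one with the smaller
  neighbourhood also witnesses an edge to the other right end, by transitivity of inclusion.\<close>

lemma crossing_free_predict:
  assumes "crossing_free A L R S"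
  shows "crossing_free (predict A L R S) L R X"
  unfolding crossing_free_def
proof (intro ballI impI)
  fix v1 v2 w1 w2
  assume "predict A L R S v1 w1" "predict A L R S v2 w2"
  then obtain r1 r2 where r: "r1 \<in> R \<inter> S" "A v1 r1" "\<forall>l\<in>L \<inter> S. A l r1 \<longrightarrow> A l w1"
    "r2 \<in> R \<inter> S" "A v2 r2" "\<forall>l\<in>L \<inter> S. A l r2 \<longrightarrow> A l w2"
    unfolding predict_def by blast
  have "(\<forall>l\<in>L \<inter> S. A l r1 \<longrightarrow> A l r2) \<or> (\<forall>l\<in>L \<inter> S. A l r2 \<longrightarrow> A l r1)"
    using crossing_freeD[OF assms] r(1,4) by blast
  then show "predict A L R S v1 w2 \<or> predict A L R S v2 w1"
    unfolding predict_def using r by blast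
qed

section \<open>Leave-two-out errors of a free sequence\<close>

text \<open>When \<open>T j\<close> is left out, \<open>T k\<close> is still sampled and is a
  candidate witness. It fails only because some sampled \<open>l\<close> sees \<open>T k\<close> but
  not \<open>T j\<close>. Exchanging \<open>j\<close> and \<open>k\<close> gives an
  \<open>l'\<close> that sees \<open>T j\<close> but not \<open>T k\<close>, and the two edges
  cross.\<close>

lemma missed_edge_unique:
  assumes free: "crossing_free A L R (T ` I)"
    and ij: "i \<in> I" "j \<in> I" "k \<in> I" "i \<noteq> j" "i \<noteq> k"
    and j: "mispredicted A L R (T ` (I - {i, j})) (T i) (T j)" "A (T i) (T j)"
    and k: "mispredicted A L R (T ` (I - {i, k})) (T i) (T k)" "A (T i) (T k)"
  shows "j = k"
proof (rule ccontr)
  assume "j \<noteq> k"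
  have R: "T j \<in> R" "T k \<in> R" using j k by (auto simp: mispredicted_def)
  have "T k \<in> T ` (I - {i, j})" "T j \<in> T ` (I - {i, k})" using ij \<open>j \<noteq> k\<close> by auto
  then obtain l l' where l: "l \<in> L" "l \<in> T ` (I - {i, j})" "A l (T k)" "\<not> A l (T j)"
    and l': "l' \<in> L" "l' \<in> T ` (I - {i, k})" "A l' (T j)" "\<not> A l' (T k)"
    using j k R unfolding mispredicted_def predict_def by blast
  then show False
    using crossing_freeD[OF free l(1) _ l'(1) _ R(2) _ R(1)] ij by blast
qed

text \<open>The witness \<open>r\<close> of the first false edge is adjacent to \<open>T i\<close>,
  but not to the sampled \<open>T k\<close>, since \<open>T k\<close> misses \<open>T j\<close>. The
  witness \<open>r'\<close> of the second behaves the other way round, so \<open>T i\<close>,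
  \<open>T k\<close>, \<open>r\<close>, \<open>r'\<close> form a crossing.\<close>

lemma spurious_edge_unique:
  assumes free: "crossing_free A L R (T ` I)"
    and ij: "i \<in> I" "k \<in> I" "j \<in> I" "i \<noteq> j" "k \<noteq> j"
    and i: "mispredicted A L R (T ` (I - {i, j})) (T i) (T j)" "\<not> A (T i) (T j)"
    and k: "mispredicted A L R (T ` (I - {k, j})) (T k) (T j)" "\<not> A (T k) (T j)"
  shows "i = k"
proof (rule ccontr)
  assume "i \<noteq> k"
  have L: "T i \<in> L" "T k \<in> L" using i k by (auto simp: mispredicted_def)
  have mem: "T k \<in> T ` (I - {i, j})" "T i \<in> T ` (I - {k, j})" using ij \<open>i \<noteq> k\<close> by auto
  have "predict A L R (T ` (I - {i, j})) (T i) (T j)" "predict A L R (T ` (I - {k, j})) (T k) (T j)"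
    using i k by (simp_all add: mispredicted_def)
  then obtain r r' where r: "r \<in> R" "r \<in> T ` (I - {i, j})" "A (T i) r" "\<forall>l\<in>L \<inter> T ` (I - {i, j}). A l r \<longrightarrow> A l (T j)"
    and r': "r' \<in> R" "r' \<in> T ` (I - {k, j})" "A (T k) r'" "\<forall>l\<in>L \<inter> T ` (I - {k, j}). A l r' \<longrightarrow> A l (T j)"
    unfolding predict_def by (elim bexE conjE IntE)
  have "\<not> A (T k) r" using r(4) mem(1) k(2) L(2) by blast
  moreover have "\<not> A (T i) r'" using r'(4) mem(2) i(2) L(1) by blast
  moreover have "T i \<in> T ` I" "T k \<in> T ` I" "r \<in> T ` I" "r' \<in> T ` I" using ij r(2) r'(2) by auto
  ultimately show False
    using crossing_freeD[OF free L(1) _ L(2) _ r(1) _ r'(1)] r(3) r'(3) by blast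
qed

text \<open>Missed edges are determined by their left index and spurious ones by their right index.
  As no index is on both sides, the two counts together are at most \<open>card I\<close>.\<close>

lemma card_mispredicted_le:
  assumes free: "crossing_free A L R (T ` I)" and disj: "L \<inter> R = {}" and "finite I"
  shows "card {(i, j). i \<in> I \<and> j \<in> I \<and> i \<noteq> j \<and> mispredicted A L R (T ` (I - {i, j})) (T i) (T j)} \<le> card I"
    (is "card ?W \<le> _")
proof -
  let ?M = "{(i, j) \<in> ?W. A (T i) (T j)}" and ?S = "{(i, j) \<in> ?W. \<not> A (T i) (T j)}"
  have W: "?W \<subseteq> I \<times> I" by auto
  have fin: "finite ?W" using finite_subset[OF W] \<open>finite I\<close> by simp
  have "inj_on fst ?M"
  proof (rule inj_onI)
    fix x y assume "x \<in> ?M" "y \<in> ?M" "fst x = fst y"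
    then show "x = y"
      using missed_edge_unique[OF free, of "fst x" "snd x" "snd y"] by (simp add: prod_eq_iff case_prod_beta)
  qed
  then have "card ?M = card (fst ` ?M)" by (simp add: card_image)
  also have "\<dots> \<le> card {i \<in> I. T i \<in> L}"
    by (rule card_mono) (use \<open>finite I\<close> in \<open>auto simp: mispredicted_def\<close>)
  finally have 1: "card ?M \<le> card {i \<in> I. T i \<in> L}" .
  have "inj_on snd ?S"
  proof (rule inj_onI)
    fix x y assume "x \<in> ?S" "y \<in> ?S" "snd x = snd y"
    then show "x = y"
      using spurious_edge_unique[OF free, of "fst x" "fst y" "snd x"] by (simp add: prod_eq_iff case_prod_beta)
  qed
  then have "card ?S = card (snd ` ?S)" by (simp add: card_image)
  also have "\<dots> \<le> card {i \<in> I. T i \<in> R}"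
    by (rule card_mono) (use \<open>finite I\<close> in \<open>auto simp: mispredicted_def\<close>)
  finally have 2: "card ?S \<le> card {i \<in> I. T i \<in> R}" .
  have "card ?W = card (?M \<union> ?S)" by (rule arg_cong[where f = card]) blast
  also have "\<dots> \<le> card ?M + card ?S" by (rule card_Un_le)
  also have "\<dots> \<le> card {i \<in> I. T i \<in> L} + card {i \<in> I. T i \<in> R}" using 1 2 by simp
  also have "\<dots> = card ({i \<in> I. T i \<in> L} \<union> {i \<in> I. T i \<in> R})"
    by (rule card_Un_disjoint[symmetric]) (use disj \<open>finite I\<close> in auto)
  also have "\<dots> \<le> card I" by (rule card_mono) (use \<open>finite I\<close> in auto)
  finally show ?thesis .
qed

section \<open>Exchangeability of independent samples\<close>

lemma extend_to_permutation:
  assumes "finite I" "A \<subseteq> I" "inj_on f A" "f ` A \<subseteq> I"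
  obtains p where "p permutes I" "\<And>x. x \<in> A \<Longrightarrow> p x = f x"
proof -
  have "card (I - A) = card (I - f ` A)"
    using assms by (simp add: card_Diff_subset finite_subset card_image)
  then obtain g where g: "bij_betw g (I - A) (I - f ` A)"
    using finite_same_card_bij[of "I - A" "I - f ` A"] assms(1) by auto
  define p where "p x = (if x \<in> A then f x else if x \<in> I then g x else x)" for x
  have "bij_betw p A (f ` A)"
    using assms(3) by (simp add: bij_betw_def inj_on_def p_def)
  moreover have "bij_betw p (I - A) (I - f ` A)"
    using g bij_betw_cong[of "I - A" p g] by (simp add: p_def)
  ultimately have "bij_betw p (A \<union> (I - A)) (f ` A \<union> (I - f ` A))"
    by (rule bij_betw_combine) blast
  then have "bij_betw p I I" using assms by (simp add: Un_absorb1)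
  then have "p permutes I"
    by (rule bij_imp_permutes) (use assms in \<open>auto simp: p_def\<close>)
  then show thesis by (rule that) (simp add: p_def)
qed

lemma bij_betw_funcset_compose_permutation:
  assumes "p permutes I"
  shows "bij_betw (\<lambda>T. T \<circ> p) (I \<rightarrow>\<^sub>E V) (I \<rightarrow>\<^sub>E V)"
proof (rule bij_betw_byWitness[where f' = "\<lambda>T. T \<circ> inv p"])
  have ip: "inv p permutes I" using assms by (rule permutes_inv)
  have *: "T \<circ> q \<in> I \<rightarrow>\<^sub>E V" if "q permutes I" "T \<in> I \<rightarrow>\<^sub>E V" for q T
    using that permutes_in_image[OF that(1)] permutes_not_in[OF that(1)] by (auto simp: PiE_iff extensional_def)
  show "(\<lambda>T. T \<circ> p) ` (I \<rightarrow>\<^sub>E V) \<subseteq> I \<rightarrow>\<^sub>E V" using *[OF assms] by blast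
  show "(\<lambda>T. T \<circ> inv p) ` (I \<rightarrow>\<^sub>E V) \<subseteq> I \<rightarrow>\<^sub>E V" using *[OF ip] by blast
  show "\<forall>T\<in>I \<rightarrow>\<^sub>E V. (T \<circ> p) \<circ> inv p = T"
    using assms by (simp add: comp_assoc permutes_inv_o)
  show "\<forall>T\<in>I \<rightarrow>\<^sub>E V. (T \<circ> inv p) \<circ> p = T"
    using assms by (simp add: comp_assoc permutes_inv_o)
qed

text \<open>By symmetry the count is the same for every ordered pair of distinct indices. Summing
  over all \<open>card I * (card I - 1)\<close> pairs and exchanging the sums, each sequence
  contributes at most \<open>card I\<close> by the previous bound; this factor cancels.\<close>

lemma card_mispredicted_at_le:
  assumes disj: "L \<inter> R = {}" and "finite I" "finite V" and ab: "a \<in> I" "b \<in> I" "a \<noteq> b"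
  shows "(card I - 1) * card {T \<in> I \<rightarrow>\<^sub>E V. crossing_free A L R (T ` I)
            \<and> mispredicted A L R (T ` (I - {a, b})) (T a) (T b)} \<le> card V ^ card I"
proof -
  let ?B = "\<lambda>i j T. crossing_free A L R (T ` I) \<and> mispredicted A L R (T ` (I - {i, j})) (T i) (T j)"
  let ?F = "I \<rightarrow>\<^sub>E V"
  let ?P = "SIGMA i:I. I - {i}"
  have finF: "finite ?F" using assms by (simp add: finite_PiE)
  have finP: "finite ?P" using \<open>finite I\<close> by simp
  have same: "card {T \<in> ?F. ?B i j T} = card {T \<in> ?F. ?B a b T}" if ij: "(i, j) \<in> ?P" for i j
  proof -
    \<comment> \<open>Reindexing by a permutation with i \<mapsto> a and j \<mapsto> b turns an
      error at \<open>(a, b)\<close> into one at \<open>(i, j)\<close> and keeps the sampled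
      set.\<close>
    obtain p where p: "p permutes I" and "\<And>x. x \<in> {i, j} \<Longrightarrow> p x = (if x = i then a else b)"
      by (rule extend_to_permutation[of I "{i, j}" "\<lambda>x. if x = i then a else b"])
        (use ij ab \<open>finite I\<close> in \<open>auto simp: inj_on_def\<close>)
    then have pij: "p i = a" "p j = b" using ij by auto
    have inj: "inj p" using p by (rule permutes_inj)
    have pI: "p ` I = I" using p by (rule permutes_image)
    have pD: "p ` (I - {i, j}) = I - {a, b}"
      by (simp add: image_set_diff[OF inj] pI pij)
    have eq: "?B i j (T \<circ> p) = ?B a b T" for T
      by (simp only: image_comp[symmetric] pI pD o_apply pij)
    have "bij_betw (\<lambda>T. T \<circ> p) {T \<in> ?F. ?B a b T} {T \<in> ?F. ?B i j T}"
      by (rule bij_betw_Collect[OF bij_betw_funcset_compose_permutation[OF p]]) (rule eq)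
    then show ?thesis by (simp add: bij_betw_same_card)
  qed
  have "card ?P = card I * (card I - 1)"
    using \<open>finite I\<close> by (simp add: card_SigmaI)
  then have "card I * (card I - 1) * card {T \<in> ?F. ?B a b T} = (\<Sum>x\<in>?P. card {T \<in> ?F. ?B a b T})"
    by simp
  also have "\<dots> = (\<Sum>x\<in>?P. card {T \<in> ?F. ?B (fst x) (snd x) T})"
    by (rule sum.cong[OF refl], rule same[symmetric]) (simp only: prod.collapse)
  also have "\<dots> = (\<Sum>x\<in>?P. \<Sum>T\<in>?F. of_bool (?B (fst x) (snd x) T))"
    using finF by (simp add: sum_of_bool_eq Int_def)
  also have "\<dots> = (\<Sum>T\<in>?F. \<Sum>x\<in>?P. of_bool (?B (fst x) (snd x) T))" by (rule sum.swap)
  also have "\<dots> \<le> (\<Sum>T\<in>?F. card I)"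
  proof (rule sum_mono)
    fix T
    show "(\<Sum>x\<in>?P. of_bool (?B (fst x) (snd x) T)) \<le> card I"
    proof (cases "crossing_free A L R (T ` I)")
      case True
      have "{x \<in> ?P. ?B (fst x) (snd x) T}
          = {(i, j). i \<in> I \<and> j \<in> I \<and> i \<noteq> j \<and> mispredicted A L R (T ` (I - {i, j})) (T i) (T j)}"
        using True by auto
      then show ?thesis
        using card_mispredicted_le[OF True disj \<open>finite I\<close>] finP by (simp add: sum_of_bool_eq Int_def)
    qed simp
  qed
  also have "\<dots> = card I * card V ^ card I"
    using assms by (simp add: card_PiE)
  finally have "card I * ((card I - 1) * card {T \<in> ?F. ?B a b T}) \<le> card I * card V ^ card I"
    by (simp only: mult.assoc)
  moreover have "card I > 0" using ab \<open>finite I\<close> by (auto simp: card_gt_0_iff)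
  ultimately show ?thesis by simp
qed

section \<open>The recurrence for free sequences\<close>

text \<open>This reduces events on \<open>t + 2\<close> samples to a sum over the first
  \<open>t\<close>, where a lower bound on the errors of each fixed sample can be inserted.\<close>

lemma card_extensions:
  assumes "finite V"
  shows "card {T \<in> {..<Suc (Suc t)} \<rightarrow>\<^sub>E V. P (T ` {..<t}) (T t) (T (Suc t))}
    = (\<Sum>S\<in>{..<t} \<rightarrow>\<^sub>E V. card {(v, w) \<in> V \<times> V. P (S ` {..<t}) v w})"
proof -
  let ?A = "{T \<in> {..<Suc (Suc t)} \<rightarrow>\<^sub>E V. P (T ` {..<t}) (T t) (T (Suc t))}"
  let ?B = "SIGMA S:{..<t} \<rightarrow>\<^sub>E V. {(v, w) \<in> V \<times> V. P (S ` {..<t}) v w}"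
  have "bij_betw (\<lambda>T. (restrict T {..<t}, T t, T (Suc t))) ?A ?B"
  proof (rule bij_betw_byWitness[where f' = "\<lambda>(S, v, w). S(t := v, Suc t := w)"])
    show "\<forall>T\<in>?A. (case (restrict T {..<t}, T t, T (Suc t)) of (S, v, w) \<Rightarrow> S(t := v, Suc t := w)) = T"
    proof
      fix T assume "T \<in> ?A"
      then have undef: "T x = undefined" if "\<not> x < t" "x \<noteq> t" "x \<noteq> Suc t" for x
        using that by (simp add: PiE_iff extensional_def)
      have "((restrict T {..<t})(t := T t, Suc t := T (Suc t))) x = T x" for x
        using undef[of x] by (cases "x < t"; cases "x = t"; cases "x = Suc t"; simp)
      then show "(case (restrict T {..<t}, T t, T (Suc t)) of (S, v, w) \<Rightarrow> S(t := v, Suc t := w)) = T"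
        by (simp add: fun_eq_iff)
    qed
    show "\<forall>x\<in>?B. (\<lambda>T. (restrict T {..<t}, T t, T (Suc t))) (case x of (S, v, w) \<Rightarrow> S(t := v, Suc t := w)) = x"
    proof
      fix x assume "x \<in> ?B"
      then obtain S v w where x: "x = (S, v, w)" and S: "S \<in> {..<t} \<rightarrow>\<^sub>E V" by blast
      have "restrict (S(t := v, Suc t := w)) {..<t} x = S x" for x
        using S by (cases "x < t") (simp_all add: PiE_iff extensional_def)
      then have "restrict (S(t := v, Suc t := w)) {..<t} = S" by blast
      then show "(\<lambda>T. (restrict T {..<t}, T t, T (Suc t))) (case x of (S, v, w) \<Rightarrow> S(t := v, Suc t := w)) = x"
        by (simp add: x)
    qed
    show "(\<lambda>T. (restrict T {..<t}, T t, T (Suc t))) ` ?A \<subseteq> ?B"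
    proof (rule image_subsetI)
      fix T assume T: "T \<in> ?A"
      have "restrict T {..<t} ` {..<t} = T ` {..<t}" by (rule image_cong) auto
      then show "(restrict T {..<t}, T t, T (Suc t)) \<in> ?B" using T by (simp add: PiE_iff)
    qed
    show "(\<lambda>(S, v, w). S(t := v, Suc t := w)) ` ?B \<subseteq> ?A"
    proof (rule image_subsetI)
      fix x assume "x \<in> ?B"
      then obtain S v w where x: "x = (S, v, w)"
        and S: "S \<in> {..<t} \<rightarrow>\<^sub>E V" "v \<in> V" "w \<in> V" "P (S ` {..<t}) v w" by blast
      have "S(t := v, Suc t := w) \<in> {..<Suc (Suc t)} \<rightarrow>\<^sub>E V"
        using S by (simp add: lessThan_Suc PiE_fun_upd)
      moreover have "(S(t := v, Suc t := w)) ` {..<t} = S ` {..<t}" by (rule image_cong) auto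
      ultimately show "(case x of (S, v, w) \<Rightarrow> S(t := v, Suc t := w)) \<in> ?A"
        using S by (simp add: x)
    qed
  qed
  then have "card ?A = card ?B" by (rule bij_betw_same_card)
  also have "\<dots> = (\<Sum>S\<in>{..<t} \<rightarrow>\<^sub>E V. card {(v, w) \<in> V \<times> V. P (S ` {..<t}) v w})"
  proof (rule card_SigmaI)
    have "finite {(v, w) \<in> V \<times> V. P X v w}" for X
      by (rule finite_subset[of _ "V \<times> V"]) (use assms in auto)
    then show "\<forall>S\<in>{..<t} \<rightarrow>\<^sub>E V. finite {(v, w) \<in> V \<times> V. P (S ` {..<t}) v w}" by blast
  qed (use assms in \<open>simp add: finite_PiE\<close>)
  finally show ?thesis .
qed

text \<open>Repetitions are allowed: these are the free outcomes of \<open>t\<close> independent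
  uniform samples, among \<open>card V ^ t\<close> outcomes in all.\<close>

definition free_seqs :: "('a \<Rightarrow> 'a \<Rightarrow> bool) \<Rightarrow> 'a set \<Rightarrow> 'a set \<Rightarrow> 'a set \<Rightarrow> nat \<Rightarrow> (nat \<Rightarrow> 'a) set" where
  "free_seqs A L R V t = {T \<in> {..<t} \<rightarrow>\<^sub>E V. crossing_free A L R (T ` {..<t})}"

text \<open>
  Extend a free sequence by two samples: a misprediction of one by the other is either a
  leave-two-out error of a free sequence or a loss of freeness.
\<close>

lemma card_free_seqs_step:
  fixes d :: real
  assumes "finite V" and disj: "L \<inter> R = {}"
    and far: "\<And>S. crossing_free A L R S \<Longrightarrow> d \<le> card {(v, w) \<in> V \<times> V. mispredicted A L R S v w}"
  shows "(t + 1) * (2 * d * card (free_seqs A L R V t) + card (free_seqs A L R V (Suc (Suc t))))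
    \<le> (t + 1) * ((card V)\<^sup>2 * card (free_seqs A L R V t)) + 2 * card V ^ Suc (Suc t)"
proof -
  let ?I = "{..<Suc (Suc t)}" and ?F = "{..<Suc (Suc t)} \<rightarrow>\<^sub>E V" and ?E = "{..<t} \<rightarrow>\<^sub>E V"
  let ?free = "crossing_free A L R" and ?mis = "mispredicted A L R"
  let ?K = "{T \<in> ?F. ?free (T ` {..<t}) \<and>
      (?mis (T ` {..<t}) (T t) (T (Suc t)) \<or> ?mis (T ` {..<t}) (T (Suc t)) (T t))}"
  let ?B1 = "{T \<in> ?F. ?free (T ` ?I) \<and> ?mis (T ` (?I - {t, Suc t})) (T t) (T (Suc t))}"
  let ?B2 = "{T \<in> ?F. ?free (T ` ?I) \<and> ?mis (T ` (?I - {Suc t, t})) (T (Suc t)) (T t)}"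
  let ?G = "{T \<in> ?F. ?free (T ` {..<t})}"
  let ?a = "\<lambda>t. card (free_seqs A L R V t)"
  have fin: "finite ?F" "finite ?E" using \<open>finite V\<close> by (simp_all add: finite_PiE)
  have sub: "free_seqs A L R V (Suc (Suc t)) \<subseteq> ?G"
  proof
    fix T assume "T \<in> free_seqs A L R V (Suc (Suc t))"
    then have "T \<in> ?F" "?free (T ` ?I)" by (simp_all add: free_seqs_def)
    moreover have "T ` {..<t} \<subseteq> T ` ?I" by (rule image_mono) auto
    ultimately show "T \<in> ?G" using crossing_free_subset by blast
  qed
  have finG: "finite ?G" using fin by simp
  have "card ?G = (\<Sum>S\<in>?E. card {(v, w) \<in> V \<times> V. ?free (S ` {..<t})})"
    by (rule card_extensions[OF \<open>finite V\<close>])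
  also have "\<dots> = (\<Sum>S\<in>?E. if ?free (S ` {..<t}) then (card V)\<^sup>2 else 0)"
  proof (rule sum.cong[OF refl])
    fix S
    have "{(v, w) \<in> V \<times> V. ?free (S ` {..<t})} = (if ?free (S ` {..<t}) then V \<times> V else {})" by auto
    then show "card {(v, w) \<in> V \<times> V. ?free (S ` {..<t})} = (if ?free (S ` {..<t}) then (card V)\<^sup>2 else 0)"
      by (simp add: power2_eq_square card_cartesian_product)
  qed
  also have "\<dots> = (card V)\<^sup>2 * ?a t"
    by (simp add: free_seqs_def flip: sum.inter_filter[OF fin(2)])
  finally have G: "card ?G = (card V)\<^sup>2 * ?a t" .
  have "2 * d * ?a t = (\<Sum>S\<in>?E. if ?free (S ` {..<t}) then 2 * d else 0)"
    by (simp add: free_seqs_def flip: sum.inter_filter[OF fin(2)])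
  also have "\<dots> \<le> (\<Sum>S\<in>?E. real (card {(v, w) \<in> V \<times> V. ?free (S ` {..<t}) \<and> (?mis (S ` {..<t}) v w \<or> ?mis (S ` {..<t}) w v)}))"
  proof (rule sum_mono)
    fix S assume "S \<in> ?E"
    let ?S = "S ` {..<t}"
    let ?M = "{(v, w) \<in> V \<times> V. ?mis ?S v w}"
    have finM: "finite ?M" by (rule finite_subset[of _ "V \<times> V"]) (use \<open>finite V\<close> in auto)
    show "(if ?free ?S then 2 * d else 0) \<le> real (card {(v, w) \<in> V \<times> V. ?free ?S \<and> (?mis ?S v w \<or> ?mis ?S w v)})"
    proof (cases "?free ?S")
      case True
      then have "{(v, w) \<in> V \<times> V. ?free ?S \<and> (?mis ?S v w \<or> ?mis ?S w v)} = ?M \<union> ?M\<inverse>" by auto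
      \<comment> \<open>Source of the factor 2: mispredicted pairs run from \<open>L\<close> to
        \<open>R\<close>, so none is the reverse of another.\<close>
      moreover have "?M \<inter> ?M\<inverse> = {}" using disj by (auto simp: mispredicted_def)
      ultimately have "card {(v, w) \<in> V \<times> V. ?free ?S \<and> (?mis ?S v w \<or> ?mis ?S w v)} = 2 * card ?M"
        using finM by (simp add: card_Un_disjoint card_inverse)
      then show ?thesis using far[OF True] True by simp
    qed simp
  qed
  also have "\<dots> = real (card ?K)"
    using card_extensions[OF \<open>finite V\<close>, of t "\<lambda>X v w. ?free X \<and> (?mis X v w \<or> ?mis X w v)"] by simp
  finally have K: "2 * d * ?a t \<le> card ?K" .
  have I: "?I - {t, Suc t} = {..<t}" "?I - {Suc t, t} = {..<t}" by auto
  have "?K \<subseteq> ?B1 \<union> ?B2 \<union> (?G - free_seqs A L R V (Suc (Suc t)))"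
  proof
    fix T assume "T \<in> ?K"
    then show "T \<in> ?B1 \<union> ?B2 \<union> (?G - free_seqs A L R V (Suc (Suc t)))"
      unfolding I free_seqs_def mem_Collect_eq Un_iff Diff_iff by blast
  qed
  then have "card ?K \<le> card (?B1 \<union> ?B2 \<union> (?G - free_seqs A L R V (Suc (Suc t))))"
    by (rule card_mono[rotated]) (use fin in simp)
  also have "\<dots> \<le> card ?B1 + card ?B2 + card (?G - free_seqs A L R V (Suc (Suc t)))"
    using card_Un_le[of "?B1 \<union> ?B2" "?G - free_seqs A L R V (Suc (Suc t))"] card_Un_le[of ?B1 ?B2]
    by linarith
  also have "card (?G - free_seqs A L R V (Suc (Suc t))) = card ?G - ?a (Suc (Suc t))"
    using sub finG by (simp add: card_Diff_subset finite_subset)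
  finally have "card ?K \<le> card ?B1 + card ?B2 + (card ?G - ?a (Suc (Suc t)))" .
  moreover have "?a (Suc (Suc t)) \<le> card ?G" using sub finG by (rule card_mono[rotated])
  ultimately have "card ?K + ?a (Suc (Suc t)) \<le> card ?B1 + card ?B2 + card ?G" by linarith
  \<comment> \<open>The factor \<open>t + 1\<close> is \<open>card ?I - 1\<close>, as in the
    exchangeability bound, which then applies to \<open>?B1\<close> and \<open>?B2\<close>.\<close>
  then have "(t + 1) * (card ?K + ?a (Suc (Suc t))) \<le> (t + 1) * card ?B1 + (t + 1) * card ?B2 + (t + 1) * card ?G"
    unfolding distrib_left[symmetric] by (rule mult_le_mono2)
  moreover have "(t + 1) * card ?B1 \<le> card V ^ Suc (Suc t)"
    using card_mispredicted_at_le[OF disj, of ?I V t "Suc t" A] \<open>finite V\<close> by (simp del: power_Suc)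
  moreover have "(t + 1) * card ?B2 \<le> card V ^ Suc (Suc t)"
    using card_mispredicted_at_le[OF disj, of ?I V "Suc t" t A] \<open>finite V\<close> by (simp del: power_Suc)
  ultimately have "(t + 1) * (card ?K + ?a (Suc (Suc t))) \<le> (t + 1) * ((card V)\<^sup>2 * ?a t) + 2 * card V ^ Suc (Suc t)"
    unfolding G by linarith
  then have "real ((t + 1) * (card ?K + ?a (Suc (Suc t)))) \<le> (t + 1) * ((card V)\<^sup>2 * ?a t) + 2 * card V ^ Suc (Suc t)"
    by (rule of_nat_mono)
  moreover have "(real t + 1) * (2 * d * ?a t + ?a (Suc (Suc t))) \<le> real ((t + 1) * (card ?K + ?a (Suc (Suc t))))"
    unfolding of_nat_mult of_nat_add of_nat_1 by (rule mult_left_mono) (use K in simp_all)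
  ultimately show ?thesis by linarith
qed

text \<open>The counting inequality with \<open>d\<close> set to \<epsilon> times the square of
  \<open>card V\<close>, divided by \<open>card V ^ (t + 2)\<close>.\<close>

lemma free_fraction_step:
  fixes p :: "nat \<Rightarrow> real" and \<epsilon> :: real
  assumes "finite V" "V \<noteq> {}" and disj: "L \<inter> R = {}"
    and far: "\<And>S. crossing_free A L R S \<Longrightarrow>
      \<epsilon> * (real (card V))\<^sup>2 \<le> card {(v, w) \<in> V \<times> V. mispredicted A L R S v w}"
    and p: "\<And>t. p t = card (free_seqs A L R V t) / real (card V) ^ t"
  shows "p (Suc (Suc t)) \<le> p t - 2 * \<epsilon> * p t + 2 / (t + 1)"
proof -
  let ?N = "real (card V)"
  have N: "?N > 0" using assms by (simp add: card_gt_0_iff)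
  have a: "card (free_seqs A L R V t) = p t * ?N ^ t" for t using N by (simp add: p)
  have "(t + 1) * (2 * (\<epsilon> * ?N\<^sup>2) * (p t * ?N ^ t) + p (Suc (Suc t)) * ?N ^ Suc (Suc t))
      \<le> (t + 1) * (?N\<^sup>2 * (p t * ?N ^ t)) + 2 * ?N ^ Suc (Suc t)"
    using card_free_seqs_step[OF assms(1) disj far, of t] a[of t] a[of "Suc (Suc t)"] by (simp add: algebra_simps)
  then have "((t + 1) * (2 * \<epsilon> * p t + p (Suc (Suc t)))) * ?N ^ Suc (Suc t) \<le> ((t + 1) * p t + 2) * ?N ^ Suc (Suc t)"
    by (simp add: algebra_simps power2_eq_square)
  then have "(t + 1) * (2 * \<epsilon> * p t + p (Suc (Suc t))) \<le> (t + 1) * p t + 2"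
    using N by (simp del: power_Suc)
  then show ?thesis by (simp add: field_simps)
qed

section \<open>Comparison with sampling without replacement\<close>

text \<open>The image of a sequence of length \<open>q\<close> lies in some \<open>q\<close>-subset,
  so after a random permutation it satisfies the hereditary \<open>Q\<close> at least as often as
  that subset does. Both fractions are compared with the common value of \<open>K\<close>.\<close>

lemma card_subsets_downward_closed_le:
  assumes "finite V" "q \<le> card V" and down: "\<And>X Y. Q X \<Longrightarrow> Y \<subseteq> X \<Longrightarrow> Q Y"
  shows "card {X. X \<subseteq> V \<and> card X = q \<and> Q X} * card V ^ q
    \<le> (card V choose q) * card {T \<in> {..<q} \<rightarrow>\<^sub>E V. Q (T ` {..<q})}"
proof -
  let ?S = "{X. X \<subseteq> V \<and> card X = q}" and ?F = "{..<q} \<rightarrow>\<^sub>E V" and ?Pi = "{p. p permutes V}"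
  let ?SQ = "{X \<in> ?S. Q X}" and ?FQ = "{T \<in> ?F. Q (T ` {..<q})}"
  \<comment> \<open>Averaging over all permutations of \<open>V\<close>: \<open>K X\<close> is the same for every \<open>q\<close>-subset \<open>X\<close>.\<close>
  define K where "K X = (\<Sum>p\<in>?Pi. of_bool (Q (p ` X)) :: nat)" for X
  have fin: "finite ?S" "finite ?F" "finite ?Pi"
    using \<open>finite V\<close> by (simp_all add: finite_PiE finite_permutations)
  have card_S: "card ?S = card V choose q" using \<open>finite V\<close> by (rule n_subsets)
  obtain X0 where X0: "X0 \<in> ?S" using obtain_subset_with_card_n[OF \<open>q \<le> card V\<close>] by blast
  have K: "K X = K X0" if X: "X \<in> ?S" for X
  proof -
    have "finite X" "finite X0" "card X = card X0" using X X0 \<open>finite V\<close> finite_subset by auto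
    then obtain h where h: "bij_betw h X X0" using finite_same_card_bij by blast
    \<comment> \<open>Right composition with \<open>r\<close> only reorders the sum over
      permutations, and it moves \<open>X\<close> onto \<open>X0\<close>.\<close>
    obtain r where r: "r permutes V" "\<And>x. x \<in> X \<Longrightarrow> r x = h x"
      by (rule extend_to_permutation[of V X h]) (use X X0 h \<open>finite V\<close> in \<open>auto simp: bij_betw_def\<close>)
    have "r ` X = X0" using r(2) h by (simp add: bij_betw_def)
    moreover have "K X = (\<Sum>p\<in>?Pi. of_bool (Q ((p \<circ> r) ` X)))"
      unfolding K_def by (rule sum_permutations_compose_right[OF r(1)])
    ultimately show ?thesis by (simp only: K_def image_comp[symmetric])
  qed
  have "card ?Pi * card ?SQ = (\<Sum>p\<in>?Pi. card ?SQ)" by simp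
  also have "\<dots> \<le> (\<Sum>p\<in>?Pi. card {X \<in> ?S. Q (p ` X)})"
  proof (rule sum_mono)
    fix p assume "p \<in> ?Pi"
    then have p: "p permutes V" "inv p permutes V" by (simp_all add: permutes_inv)
    have pinv: "p ` inv p ` X = X" for X
      using permutes_inv_o(1)[OF p(1)] by (simp add: image_comp)
    show "card ?SQ \<le> card {X \<in> ?S. Q (p ` X)}"
    proof (rule card_inj_on_le[where f = "image (inv p)"])
      show "inj_on (image (inv p)) ?SQ" by (rule inj_onI) (metis pinv)
      have "inv p ` X \<in> ?S" if "X \<in> ?S" for X
        using that permutes_image[OF p(2)] inj_on_subset[OF permutes_inj[OF p(2)]]
        by (auto simp: card_image)
      then show "image (inv p) ` ?SQ \<subseteq> {X \<in> ?S. Q (p ` X)}" using pinv by auto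
    qed (rule finite_subset[OF _ fin(1)], blast)
  qed
  also have "\<dots> = (\<Sum>p\<in>?Pi. \<Sum>X\<in>?S. of_bool (Q (p ` X)))"
    using fin by (simp add: sum_of_bool_eq Int_def)
  also have "\<dots> = (\<Sum>X\<in>?S. K X)" unfolding K_def by (rule sum.swap)
  also have "\<dots> = (\<Sum>X\<in>?S. K X0)" by (rule sum.cong[OF refl]) (rule K)
  also have "\<dots> = (card V choose q) * K X0" by (simp add: card_S)
  finally have 1: "card ?Pi * card ?SQ \<le> (card V choose q) * K X0" .
  have "card V ^ q * K X0 = (\<Sum>T\<in>?F. K X0)" by (simp add: card_PiE)
  also have "\<dots> \<le> (\<Sum>T\<in>?F. \<Sum>p\<in>?Pi. of_bool (Q (p ` T ` {..<q})))"
  proof (rule sum_mono)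
    fix T assume T: "T \<in> ?F"
    have sub: "T ` {..<q} \<subseteq> V" using T by auto
    have "card (T ` {..<q}) \<le> q" using card_image_le[of "{..<q}" T] by simp
    \<comment> \<open>Repeated entries make the image smaller than \<open>q\<close>; it is padded to
      a \<open>q\<close>-subset so that the constancy of \<open>K\<close> applies.\<close>
    then obtain X where X: "T ` {..<q} \<subseteq> X" "X \<subseteq> V" "card X = q"
      using exists_subset_between[OF _ \<open>q \<le> card V\<close> sub \<open>finite V\<close>] by blast
    have "K X0 = K X" using K[of X] X by simp
    also have "\<dots> \<le> (\<Sum>p\<in>?Pi. of_bool (Q (p ` T ` {..<q})))"
      unfolding K_def
    proof (rule sum_mono)
      fix p
      show "(of_bool (Q (p ` X)) :: nat) \<le> of_bool (Q (p ` T ` {..<q}))"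
        using down[of "p ` X" "p ` T ` {..<q}"] image_mono[OF X(1), of p] by simp
    qed
    finally show "K X0 \<le> (\<Sum>p\<in>?Pi. of_bool (Q (p ` T ` {..<q})))" .
  qed
  also have "\<dots> = (\<Sum>p\<in>?Pi. \<Sum>T\<in>?F. of_bool (Q (p ` T ` {..<q})))" by (rule sum.swap)
  also have "\<dots> = (\<Sum>p\<in>?Pi. card {T \<in> ?F. Q (p ` T ` {..<q})})"
    using fin by (simp add: sum_of_bool_eq Int_def)
  also have "\<dots> \<le> (\<Sum>p\<in>?Pi. card ?FQ)"
  proof (rule sum_mono)
    fix p assume "p \<in> ?Pi"
    then have p: "p permutes V" by simp
    show "card {T \<in> ?F. Q (p ` T ` {..<q})} \<le> card ?FQ"
    proof (rule card_inj_on_le[where f = "\<lambda>T. restrict (p \<circ> T) {..<q}"])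
      show "inj_on (\<lambda>T. restrict (p \<circ> T) {..<q}) {T \<in> ?F. Q (p ` T ` {..<q})}"
      proof (rule inj_onI)
        fix T U
        assume T: "T \<in> {T \<in> ?F. Q (p ` T ` {..<q})}" and U: "U \<in> {T \<in> ?F. Q (p ` T ` {..<q})}"
          and eq: "restrict (p \<circ> T) {..<q} = restrict (p \<circ> U) {..<q}"
        have "T i = U i" if "i < q" for i
          using fun_cong[OF eq, of i] that permutes_inj[OF p] by (simp add: inj_eq)
        then show "T = U" using T U by (intro PiE_ext[of T "{..<q}" "\<lambda>_. V" U]) auto
      qed
      show "(\<lambda>T. restrict (p \<circ> T) {..<q}) ` {T \<in> ?F. Q (p ` T ` {..<q})} \<subseteq> ?FQ"
      proof (rule image_subsetI)
        fix T assume T: "T \<in> {T \<in> ?F. Q (p ` T ` {..<q})}"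
        have "restrict (p \<circ> T) {..<q} ` {..<q} = p ` T ` {..<q}" by auto
        moreover have "restrict (p \<circ> T) {..<q} \<in> ?F"
          using T permutes_in_image[OF p] by (auto simp: PiE_iff)
        ultimately show "restrict (p \<circ> T) {..<q} \<in> ?FQ" using T by simp
      qed
    qed (use fin in simp)
  qed
  also have "\<dots> = card ?Pi * card ?FQ" by simp
  finally have 2: "card V ^ q * K X0 \<le> card ?Pi * card ?FQ" .
  have "card ?Pi * (card ?SQ * card V ^ q) \<le> (card V choose q) * (card V ^ q * K X0)"
    using mult_le_mono1[OF 1, of "card V ^ q"] by (simp add: mult_ac)
  also have "\<dots> \<le> (card V choose q) * (card ?Pi * card ?FQ)" using 2 by (rule mult_le_mono2)
  finally have "card ?Pi * (card ?SQ * card V ^ q) \<le> card ?Pi * ((card V choose q) * card ?FQ)"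
    by (simp add: mult_ac)
  moreover have "card ?Pi > 0" using \<open>finite V\<close> by (simp add: card_permutations[OF refl])
  moreover have "?SQ = {X. X \<subseteq> V \<and> card X = q \<and> Q X}" by blast
  ultimately show ?thesis by simp
qed

section \<open>Solving the recurrence\<close>

text \<open>If the value at \<open>q\<close> exceeds 1/2, then walking back from \<open>q\<close>
  two indices at a time raises it by at least \<epsilon>/2 per step. After \<open>q div 4\<close>
  steps it would exceed 1.\<close>

lemma decay_at_sample_size:
  fixes p :: "nat \<Rightarrow> real"
  assumes eps: "0 < \<epsilon>" "\<epsilon> \<le> 1 / 8"
    and step: "\<And>t. p (Suc (Suc t)) \<le> p t - 2 * \<epsilon> * p t + 2 / (t + 1)"
    and le_1: "\<And>t. p t \<le> 1"
  shows "p (sample_size \<epsilon>) \<le> 1 / 2"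
proof (rule ccontr)
  define q where "q = sample_size \<epsilon>"
  \<comment> \<open>With this many steps of length two the index stays at or above
    \<open>q / 2\<close>, which keeps the error term \<open>2 / (t + 1)\<close> small.\<close>
  define k where "k = q div 4"
  assume "\<not> p (sample_size \<epsilon>) \<le> 1 / 2"
  then have start: "p q > 1 / 2" by (simp add: q_def)
  \<comment> \<open>Since \<epsilon> \<le> 1/8, the logarithm in the sample size is at least 2,
    whence \<open>q\<close> \<ge> 8/\<epsilon>.\<close>
  have "ln (8 :: real) = 3 * ln 2" using ln_realpow[of 2 3] by simp
  then have "2 \<le> ln (8 :: real)" using ln2_ge_two_thirds by simp
  also have "ln 8 \<le> ln (1 / \<epsilon>)" using eps by (simp add: field_simps)
  finally have "8 / \<epsilon> \<le> 4 / \<epsilon> * ln (1 / \<epsilon>)" using eps by (simp add: field_simps)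
  also have "\<dots> \<le> real q" unfolding q_def sample_size_def by linarith
  finally have q: "8 \<le> real q * \<epsilon>" using eps by (simp add: field_simps)
  have "p (q - 2 * j) > 1 / 2 + j * \<epsilon> / 2" if "j \<le> k" for j
    using that
  proof (induction j)
    case 0
    then show ?case using start by simp
  next
    case (Suc j)
    define t where "t = q - 2 * Suc j"
    have t: "q - 2 * j = Suc (Suc t)" "q \<le> 2 * t" using Suc.prems unfolding t_def k_def by auto
    have "real q \<le> 2 * real t" using t(2) by linarith
    then have "real q * \<epsilon> \<le> 2 * real t * \<epsilon>" using eps by (intro mult_right_mono) auto
    then have "8 \<le> 2 * real t * \<epsilon>" using q by linarith
    then have small: "2 / (t + 1) \<le> \<epsilon> / 2" using eps by (simp add: field_simps)
    have IH: "1 / 2 + j * \<epsilon> / 2 < p (Suc (Suc t))" using Suc t(1) by simp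
    have "0 \<le> j * \<epsilon>" using eps by simp
    then have up: "p t * (1 - 2 * \<epsilon>) > 1 / 2 + j * \<epsilon> / 2 - \<epsilon> / 2"
      using IH step[of t] small by (simp add: algebra_simps)
    \<comment> \<open>Bootstrapping: this makes the gain 2\<epsilon> \<open>p t\<close> at least
      \<epsilon>, of which the error term consumes at most half.\<close>
    have "p t > 1 / 2"
    proof (rule ccontr)
      assume "\<not> p t > 1 / 2"
      then have "p t * (1 - 2 * \<epsilon>) \<le> 1 / 2 * (1 - 2 * \<epsilon>)" using eps by (intro mult_right_mono) auto
      then have "p t * (1 - 2 * \<epsilon>) \<le> 1 / 2 - \<epsilon>" by (simp add: algebra_simps)
      then show False using up \<open>0 \<le> j * \<epsilon>\<close> eps by linarith
    qed
    then have "\<epsilon> \<le> 2 * \<epsilon> * p t" using eps by simp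
    moreover have "p t * (1 - 2 * \<epsilon>) = p t - 2 * \<epsilon> * p t" by (simp add: algebra_simps)
    moreover have "Suc j * \<epsilon> / 2 = j * \<epsilon> / 2 + \<epsilon> / 2" by (simp add: field_simps)
    ultimately have "p t > 1 / 2 + Suc j * \<epsilon> / 2" using up by linarith
    then show ?case by (simp add: t_def)
  qed
  then have "1 / 2 + k * \<epsilon> / 2 < 1" using le_1 order_less_le_trans by blast
  \<comment> \<open>Rounding in \<open>q div 4\<close> costs at most 3\<epsilon> \<le> 3/8, so
    4\<open>k\<close>\<epsilon> is still at least 8 - 3/8, whereas the preceding bound gives
    \<open>k\<close>\<epsilon> < 1.\<close>
  moreover have "real q \<le> 4 * k + 3" unfolding k_def by linarith
  then have "real q * \<epsilon> \<le> (4 * k + 3) * \<epsilon>" using eps by (intro mult_right_mono) auto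
  ultimately show False using q eps by (simp add: algebra_simps)
qed

section \<open>Translation to \<open>contains_M2\<close> and edit distance\<close>

lemma contains_M2_iff:
  assumes "L \<inter> R = {}" and F: "\<And>l r. l \<in> L \<inter> X \<Longrightarrow> r \<in> R \<inter> X \<Longrightarrow> {l, r} \<in> F \<longleftrightarrow> A l r"
  shows "contains_M2 (L \<inter> X) (R \<inter> X) F \<longleftrightarrow> \<not> crossing_free A L R X"
proof -
  have "(distinct [l1, l2, r1, r2] \<and> {l1, r1} \<in> F \<and> {l2, r2} \<in> F \<and> {l1, r2} \<notin> F \<and> {l2, r1} \<notin> F)
      \<longleftrightarrow> \<not> (A l1 r1 \<longrightarrow> A l2 r2 \<longrightarrow> A l1 r2 \<or> A l2 r1)"
    if lr: "l1 \<in> L \<inter> X" "l2 \<in> L \<inter> X" "r1 \<in> R \<inter> X" "r2 \<in> R \<inter> X" for l1 l2 r1 r2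
  proof -
    have "l1 \<noteq> r1" "l1 \<noteq> r2" "l2 \<noteq> r1" "l2 \<noteq> r2" using lr \<open>L \<inter> R = {}\<close> by blast+
    then show ?thesis using F lr by (cases "l1 = l2"; cases "r1 = r2"; simp)
  qed
  then show ?thesis
    unfolding contains_M2_def crossing_free_def by (simp only: Set.ball_simps(10) cong: bex_cong)
qed

lemma contains_M2_bip_iff:
  assumes "L \<inter> R = {}"
  shows "contains_M2 (L \<inter> X) (R \<inter> X) (bip E (L \<inter> X) (R \<inter> X))
    \<longleftrightarrow> \<not> crossing_free (\<lambda>v w. {v, w} \<in> E) L R X"
  by (rule contains_M2_iff[OF assms]) (unfold bip_def cross_pairs_def, blast)

text \<open>Flipping exactly the mispredicted pairs turns the bipartite graph into the predicted
  one, which is free. Hence the flipped set is one of the changes bounded below by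
  \<open>d\<close>.\<close>

lemma many_mispredicted:
  assumes disj: "L \<inter> R = {}" and "finite V" "L \<union> R \<subseteq> V"
    and far: "M2_free_needs L R (bip E L R) d"
    and free: "crossing_free (\<lambda>v w. {v, w} \<in> E) L R S"
  shows "d \<le> card {(v, w) \<in> V \<times> V. mispredicted (\<lambda>v w. {v, w} \<in> E) L R S v w}"
proof -
  let ?A = "\<lambda>v w. {v, w} \<in> E"
  let ?M = "{(v, w) \<in> V \<times> V. mispredicted ?A L R S v w}"
  let ?C = "(\<lambda>(v, w). {v, w}) ` ?M"
  have finM: "finite ?M" by (rule finite_subset[of _ "V \<times> V"]) (use \<open>finite V\<close> in auto)
  \<comment> \<open>Passing to unordered pairs loses no information, because disjointness of the
    parts recovers the orientation.\<close>
  have C: "{l, r} \<in> ?C \<longleftrightarrow> mispredicted ?A L R S l r" if "l \<in> L" "r \<in> R" for l r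
  proof
    assume "{l, r} \<in> ?C"
    then obtain x where x: "{l, r} = (\<lambda>(v, w). {v, w}) x" "x \<in> ?M" by (rule imageE)
    obtain v w where "x = (v, w)" by (cases x)
    then have vw: "mispredicted ?A L R S v w" "{l, r} = {v, w}" using x by simp_all
    then have "v \<in> L" "w \<in> R" by (simp_all add: mispredicted_def)
    then have "l = v" "r = w" using vw(2) that disj unfolding doubleton_eq_iff by blast+
    then show "mispredicted ?A L R S l r" using vw(1) by simp
  next
    assume "mispredicted ?A L R S l r"
    then show "{l, r} \<in> ?C" using that assms(3) by (intro image_eqI[where x = "(l, r)"]) auto
  qed
  have change: "{l, r} \<in> change (bip E L R) ?C \<longleftrightarrow> predict ?A L R S l r" if "l \<in> L" "r \<in> R" for l r
  proof -
    have "{l, r} \<in> bip E L R \<longleftrightarrow> {l, r} \<in> E"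
      using that unfolding bip_def cross_pairs_def by blast
    then show ?thesis using C[OF that] that by (auto simp: change_def mispredicted_def)
  qed
  have "\<not> contains_M2 L R (change (bip E L R) ?C)"
    using contains_M2_iff[OF disj, of UNIV "change (bip E L R) ?C" "predict ?A L R S"] change
      crossing_free_predict[OF free, of UNIV] by simp
  moreover have "?C \<subseteq> cross_pairs L R" by (auto simp: cross_pairs_def mispredicted_def)
  ultimately have "d \<le> card ?C" using far unfolding M2_free_needs_def by blast
  also have "card ?C \<le> card ?M" using finM by (rule card_image_le)
  finally show ?thesis by simp
qed

text \<open>Both the empty and the complete bipartite graph are free, and the cheaper of the two
  changes at most half of the \<open>card L * card R\<close> pairs. The product is at most a quarter
  of the square of \<open>card V\<close>.\<close>

lemma M2_free_needs_le:
  assumes "finite V" "V = L \<union> R" and disj: "L \<inter> R = {}"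
    and far: "M2_free_needs L R (bip E L R) d"
  shows "8 * d \<le> (real (card V))\<^sup>2"
proof -
  let ?X = "cross_pairs L R" and ?F = "bip E L R"
  have fin: "finite L" "finite R" using assms by auto
  have X: "?X = (\<lambda>(l, r). {l, r}) ` (L \<times> R)" by (auto simp: cross_pairs_def)
  have finX: "finite ?X" using fin by (simp add: X)
  have F: "?F \<subseteq> ?X" by (simp add: bip_def)
  have "\<not> contains_M2 L R (change ?F ?F)" by (simp add: contains_M2_def change_def)
  then have 1: "d \<le> card ?F" using far F unfolding M2_free_needs_def by blast
  have "change ?F (?X - ?F) = ?X" using F by (auto simp: change_def)
  moreover have "\<not> contains_M2 L R ?X" unfolding contains_M2_def cross_pairs_def by blast
  ultimately have "\<not> contains_M2 L R (change ?F (?X - ?F))" by simp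
  then have 2: "d \<le> card (?X - ?F)"
    by (rule far[unfolded M2_free_needs_def, rule_format, OF Diff_subset])
  have "card ?F + card (?X - ?F) = card ?X"
    using card_mono[OF finX F] card_Diff_subset[OF finite_subset[OF F finX] F] by linarith
  also have "\<dots> \<le> card L * card R"
    using card_image_le[of "L \<times> R" "\<lambda>(l, r). {l, r}"] fin by (simp add: X card_cartesian_product)
  finally have "2 * d \<le> real (card L * card R)" using 1 2 by linarith
  moreover have "4 * (real (card L) * card R) \<le> (real (card L) + card R)\<^sup>2"
    using sum_squares_ge_zero[of "real (card L) - card R" 0] by (simp add: power2_eq_square algebra_simps)
  moreover have "real (card V) = real (card L) + card R" using assms fin by (simp add: card_Un_disjoint)
  ultimately show ?thesis by simp
qed

theorem theorem6:
  fixes \<epsilon> :: real and n :: nat and V L R :: "'a set" and E :: "'a set set"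
  assumes "\<epsilon> > 0"
    and "n \<ge> 1"
    and "simple_graph V E"
    and "V = L \<union> R" and "L \<inter> R = {}"
    and "card V \<le> n"
    and "M2_free_needs L R (bip E L R) (\<epsilon> * (real n)\<^sup>2)"
  shows "measure_pmf.prob (pmf_of_set (samples V (sample_size \<epsilon>)))
           {X. contains_M2 (L \<inter> X) (R \<inter> X) (bip E (L \<inter> X) (R \<inter> X))} \<ge> 1 / 2"
proof -
  let ?A = "\<lambda>v w. {v, w} \<in> E"
  define q where "q = sample_size \<epsilon>"
  let ?S = "samples V q" and ?M = "{X. \<not> crossing_free ?A L R X}"
  have "finite V" using assms(3) by (simp add: simple_graph_def)
  have finS: "finite ?S" using \<open>finite V\<close> by (simp add: samples_def)
  have card_S: "card ?S = card V choose (min q (card V))"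
    unfolding samples_def using \<open>finite V\<close> by (rule n_subsets)
  have S_pos: "card ?S > 0" by (simp add: card_S)
  then have prob: "measure_pmf.prob (pmf_of_set ?S) ?M = card (?S \<inter> ?M) / card ?S"
    using finS by (intro measure_pmf_of_set) auto
  have n2: "(real (card V))\<^sup>2 \<le> (real n)\<^sup>2" using assms(6) by (intro power_mono) auto
  have pos: "\<epsilon> * (real n)\<^sup>2 > 0" using assms(1,2) by simp
  \<comment> \<open>Otherwise the empty change would do, although a positive number of changes is
    required. This settles the case where the sample is all of \<open>V\<close>.\<close>
  have V_M: "\<not> crossing_free ?A L R V"
  proof
    assume "crossing_free ?A L R V"
    then have "\<not> contains_M2 L R (bip E L R)"
      using contains_M2_bip_iff[OF assms(5), of V E] assms(4) by (simp add: Int_absorb2)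
    then have "\<epsilon> * (real n)\<^sup>2 \<le> card ({} :: 'a set set)"
      using assms(7) unfolding M2_free_needs_def change_def by (metis Diff_empty Un_empty_right empty_Diff empty_subsetI)
    then show False using pos by simp
  qed
  have "1 / 2 \<le> real (card (?S \<inter> ?M)) / card ?S"
  proof (cases "card V \<le> q")
    case True
    then have "?S = {V}"
      unfolding samples_def using \<open>finite V\<close> card_subset_eq by (auto simp: min_def)
    then show ?thesis using V_M by simp
  next
    case False
    define p where "p t = real (card (free_seqs ?A L R V t)) / real (card V) ^ t" for t
    have V: "V \<noteq> {}" "card V > 0" using False by auto
    have "8 * (\<epsilon> * (real n)\<^sup>2) \<le> (real n)\<^sup>2"
      using M2_free_needs_le[OF \<open>finite V\<close> assms(4,5,7)] n2 by linarith
    then have eps: "\<epsilon> \<le> 1 / 8" using assms(2) by simp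
    \<comment> \<open>The distance is assumed relative to \<open>n\<close>, while the recurrence
      measures it against \<open>card V\<close> \<le> \<open>n\<close>.\<close>
    have far: "\<epsilon> * (real (card V))\<^sup>2 \<le> card {(v, w) \<in> V \<times> V. mispredicted ?A L R S v w}"
      if "crossing_free ?A L R S" for S
    proof -
      have "\<epsilon> * (real (card V))\<^sup>2 \<le> \<epsilon> * (real n)\<^sup>2" using n2 assms(1) by (intro mult_left_mono) auto
      also have "\<dots> \<le> card {(v, w) \<in> V \<times> V. mispredicted ?A L R S v w}"
        by (rule many_mispredicted[OF assms(5) \<open>finite V\<close> _ assms(7) that]) (simp add: assms(4))
      finally show ?thesis .
    qed
    have step: "p (Suc (Suc t)) \<le> p t - 2 * \<epsilon> * p t + 2 / (t + 1)" for t
      by (rule free_fraction_step[OF \<open>finite V\<close> V(1) assms(5) far p_def])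
    have "p t \<le> 1" for t
    proof -
      have "card (free_seqs ?A L R V t) \<le> card ({..<t} \<rightarrow>\<^sub>E V)"
        by (rule card_mono) (use \<open>finite V\<close> in \<open>auto simp: free_seqs_def finite_PiE\<close>)
      then have "real (card (free_seqs ?A L R V t)) \<le> real (card V) ^ t"
        by (simp add: card_PiE flip: of_nat_power)
      then show ?thesis using V by (simp add: p_def)
    qed
    then have half: "p q \<le> 1 / 2"
      unfolding q_def using decay_at_sample_size[OF assms(1) eps step] by blast
    \<comment> \<open>Freeness is hereditary, so the bound for independent samples carries over to
      uniform \<open>q\<close>-subsets.\<close>
    have "card {X. X \<subseteq> V \<and> card X = q \<and> crossing_free ?A L R X} * card V ^ q
        \<le> (card V choose q) * card (free_seqs ?A L R V q)"
      unfolding free_seqs_def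
      by (rule card_subsets_downward_closed_le) (use False \<open>finite V\<close> crossing_free_subset in auto)
    moreover have "{X. X \<subseteq> V \<and> card X = q \<and> crossing_free ?A L R X} = ?S - ?M"
      using False by (auto simp: samples_def)
    moreover have "card V choose q = card ?S" using False by (simp add: card_S)
    ultimately have "real (card (?S - ?M) * card V ^ q) \<le> card ?S * card (free_seqs ?A L R V q)"
      by (simp only: of_nat_mono)
    then have "real (card (?S - ?M)) \<le> card ?S * p q"
      using V by (simp add: p_def field_simps)
    also have "\<dots> \<le> card ?S * (1 / 2)" using half by (intro mult_left_mono) auto
    finally have "2 * real (card (?S - ?M)) \<le> card ?S" by simp
    moreover have "card ?S = card (?S \<inter> ?M) + card (?S - ?M)"
      using card_Int_Diff[OF finS] by blast
    ultimately have "real (card ?S) \<le> 2 * real (card (?S \<inter> ?M))" by linarith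
    then show ?thesis using S_pos by (simp add: pos_le_divide_eq)
  qed
  then show ?thesis
    using prob by (simp add: contains_M2_bip_iff[OF assms(5)] q_def)
qed

end
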